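(* Let $q\ge2$, $\sigma>0$, and let $\mathbf Z_1,\dots,\mathbf Z_n$ be independent real-valued random variables with $\mathbb{E}[\mathbf Z_i]=0$, $\mathbb{E}[\mathbf Z_i^2]=1$ and $\mathbb{E}[|\mathbf Z_i|^q]\le\sigma^{2-q}$. Let $f=\sum_{S\subseteq[n]}a_S\prod_{i\in S}\mathbf Z_i$ with real coefficients $a_S$, and let $\rho<\frac{1}{2q^{1.5}}$. Then $\|\mathrm{T}_\rho f\|_q^q\le\sum_{S\subseteq[n]}\sigma^{(2-q)|S|}\|\mathrm{D}_S(f)\|_2^q$.
   Context: Here $\mathrm{T}_\rho f=\sum_S\rho^{|S|}a_S\prod_{i\in S}\mathbf Z_i$ and $\mathrm{D}_T(f)=\sum_{S\supseteq T}a_S\prod_{i\in S\setminus T}\mathbf Z_i$; norms are $\|X\|_r=(\mathbb{E}|X|^r)^{1/r}$ for random variables $X$.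
   Formalization: The condition ρ < 1/(2q^{1.5}) is read as |ρ| < 1/(2q^{1.5}), since the claim fails for very negative ρ (for instance q = 2, n = 1, f = Z_1, ρ = −100 gives 10^4 ≤ 2). *)

theory Defs
  imports "HOL-Probability.Probability"
begin

text \<open>
  The polynomial \<open>f = (\<Sum>S\<subseteq>[n]. a S * (\<Prod>i\<in>S. Z i))\<close> is represented by its coefficients \<open>a\<close>, and the
  operators on \<open>f\<close> take \<open>a\<close> and \<open>Z\<close> as arguments. The values of \<open>a\<close> on sets that are not contained
  in \<open>[n] = {1..n}\<close> play no role.
\<close>

definition noise_op ::
  "nat \<Rightarrow> (nat \<Rightarrow> 'a \<Rightarrow> real) \<Rightarrow> real \<Rightarrow> (nat set \<Rightarrow> real) \<Rightarrow> 'a \<Rightarrow> real"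
  where "noise_op n Z \<rho> a \<omega> = (\<Sum>S\<in>Pow {1..n}. \<rho> ^ card S * a S * (\<Prod>i\<in>S. Z i \<omega>))"

definition deriv_op ::
  "nat \<Rightarrow> (nat \<Rightarrow> 'a \<Rightarrow> real) \<Rightarrow> nat set \<Rightarrow> (nat set \<Rightarrow> real) \<Rightarrow> 'a \<Rightarrow> real"
  where "deriv_op n Z T a \<omega> = (\<Sum>S\<in>{S \<in> Pow {1..n}. T \<subseteq> S}. a S * (\<Prod>i\<in>S - T. Z i \<omega>))"

text \<open>
  The Bochner integral of a non-integrable function is 0, so this is the \<open>L\<^sup>r\<close> norm only when
  \<open>\<bar>X\<bar> powr r\<close> is integrable.
\<close>

definition Lnorm :: "'a measure \<Rightarrow> real \<Rightarrow> ('a \<Rightarrow> real) \<Rightarrow> real"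
  where "Lnorm M r X = (\<integral>\<omega>. \<bar>X \<omega>\<bar> powr r \<partial>M) powr (1 / r)"

end

theory Submission
  imports Defs
begin

text \<open>
  For vectors \<open>x\<close>, \<open>y\<close> of a Euclidean space and one random variable \<open>Z\<close> as in the theorem,
  \<open>E \<bar>x + \<rho> Z y\<bar>\<^sup>q \<le> (\<bar>x\<bar>\<^sup>2 + \<bar>y\<bar>\<^sup>2)\<^bsup>q/2\<^esup> + \<sigma>\<^bsup>2-q\<^esup> \<bar>y\<bar>\<^sup>q\<close>.
  Indeed, a second-order expansion of \<open>\<bar>x + t y\<bar>\<^sup>q\<close> in \<open>t\<close> is valid up to an error
  \<open>2 q\<^sup>2 \<bar>x\<bar>\<^bsup>q-2\<^esup> \<bar>t y\<bar>\<^sup>2\<close> when \<open>\<bar>t y\<bar>\<close> is small compared with \<open>\<bar>x\<bar>/q\<close>, and up to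
  \<open>2 (2q)\<^sup>q \<bar>t y\<bar>\<^sup>q\<close> otherwise; the expectation kills the linear term and the smallness of \<open>\<rho>\<close>
  absorbs both constants. Writing a polynomial as \<open>g + Z\<^sub>i h\<close>, this inequality trades the variable
  \<open>Z\<^sub>i\<close> for a vector \<open>(g, h)\<close> of polynomials without \<open>Z\<^sub>i\<close>, plus the term of the derivative \<open>h\<close>.
  When no variables are left, the squared lengths are the sums of \<open>a\<^sub>T\<^sup>2\<close> over \<open>T \<supseteq> S\<close>, which equal
  \<open>\<parallel>D\<^sub>S f\<parallel>\<^sub>2\<^sup>2\<close> because the monomials are orthonormal.
\<close>

section \<open>Elementary inequalities for exponentials and real powers\<close>

lemma exp_le_quadratic:
  fixes x :: real
  assumes "x \<le> 1"
  shows "exp x \<le> 1 + x + x\<^sup>2"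
proof (cases "0 \<le> x")
  case True
  then show ?thesis using exp_bound assms by blast
next
  case False
  have "1 - x \<le> exp (- x)"
    using exp_ge_add_one_self[of "- x"] by simp
  then have "exp x * (1 - x) \<le> exp x * exp (- x)"
    by (intro mult_left_mono) auto
  also have "\<dots> = 1"
    by (simp flip: exp_add)
  \<comment> \<open>The product equals \<open>1 - x ^ 3\<close>, which exceeds 1 for negative
    \<open>x\<close>.\<close>
  also have "\<dots> \<le> (1 + x + x\<^sup>2) * (1 - x)"
    using False power3_eq_cube[of x] mult_nonneg_nonpos[of "x\<^sup>2" x]
    by (simp add: algebra_simps power2_eq_square)
  finally show ?thesis
    using False by (simp add: mult_le_cancel_right)
qed

text \<open>Bernoulli's inequality for real exponents: the derivative of
  \<open>(1 + x) powr p\<close> is at least \<open>p\<close> for nonnegative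
  \<open>x\<close>.\<close>

lemma one_add_powr_ge:
  fixes x p :: real
  assumes "p \<ge> 1" "x \<ge> 0"
  shows "1 + p * x \<le> (1 + x) powr p"
proof (cases "x = 0")
  case False
  have "\<exists>z. 0 < z \<and> z < x \<and> (1 + x) powr p - (1 + 0) powr p = (x - 0) * (p * (1 + z) powr (p - 1))"
    using False assms by (intro MVT2) (auto intro!: derivative_eq_intros)
  then obtain z where z: "0 < z" "(1 + x) powr p - 1 = x * (p * (1 + z) powr (p - 1))"
    by auto
  have "1 \<le> (1 + z) powr (p - 1)"
    using z assms by (simp add: ge_one_powr_ge_zero)
  then have "x * (p * 1) \<le> x * (p * (1 + z) powr (p - 1))"
    using assms by (intro mult_left_mono) auto
  with z show ?thesis by (simp add: algebra_simps)
qed simp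

text \<open>A convex power lies above its tangent at \<open>A\<close>; scaling by \<open>A\<close>
  reduces this to Bernoulli's inequality. With \<open>p = q / 2\<close> it later absorbs the
  quadratic error term into \<open>(A + C) powr (q / 2)\<close>.\<close>

lemma add_powr_ge:
  fixes A C p :: real
  assumes "p \<ge> 1" "A \<ge> 0" "C \<ge> 0"
  shows "A powr p + p * C * A powr (p - 1) \<le> (A + C) powr p"
proof (cases "A = 0")
  case False
  then have A: "A > 0" using assms by simp
  have "A powr p + p * C * A powr (p - 1) = A powr p * (1 + p * (C / A))"
    using A by (simp add: field_simps powr_diff)
  also have "\<dots> \<le> A powr p * (1 + C / A) powr p"
    using assms A by (intro mult_left_mono one_add_powr_ge) auto
  also have "\<dots> = (A + C) powr p"
    using assms A by (simp add: distrib_left flip: powr_mult)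
  finally show ?thesis .
qed simp

section \<open>Second-order expansion of a power of the Euclidean norm along a line\<close>

text \<open>Cauchy-Schwarz for the cross term: \<open>A\<close>, \<open>B\<close>, \<open>C\<close>
  stand for the squared length of x, the inner product of x and y, and the squared length of
  y.\<close>

lemma abs_mult_le_of_square_le:
  fixes A B C t :: real
  assumes "B\<^sup>2 \<le> A * C" "A \<ge> 0" "C \<ge> 0"
  shows "\<bar>B * t\<bar> \<le> sqrt A * (sqrt C * \<bar>t\<bar>)"
proof -
  have "\<bar>B\<bar> \<le> sqrt (A * C)"
    using assms by (simp add: real_le_rsqrt)
  then have "\<bar>B\<bar> * \<bar>t\<bar> \<le> (sqrt A * sqrt C) * \<bar>t\<bar>"
    by (intro mult_right_mono) (auto simp: real_sqrt_mult)
  then show ?thesis by (simp add: abs_mult mult.assoc)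
qed

lemma square_powr_half:
  fixes s q :: real
  assumes "s \<ge> 0"
  shows "(s\<^sup>2) powr (q / 2) = s powr q"
  using assms by (simp add: powr_powr flip: powr_numeral)

text \<open>Factoring out \<open>A\<close> leaves \<open>(1 + w) powr (q / 2)\<close>, which is at
  most \<open>exp (q / 2 * w)\<close>. The smallness condition gives
  \<open>q / 2 * w \<le> 1\<close>, the range in which \<open>exp_le_quadratic\<close>
  applies.\<close>

lemma powr_quadratic_le_small:
  fixes A B C t q :: real
  assumes q: "q \<ge> 2" and AC: "A > 0" "C \<ge> 0" "B\<^sup>2 \<le> A * C"
    and small: "(q + 1) * (sqrt C * \<bar>t\<bar>) \<le> sqrt A"
  shows "(A + 2 * B * t + C * t\<^sup>2) powr (q / 2)
    \<le> A powr (q / 2) + q * B * A powr (q / 2 - 1) * t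
       + 2 * q\<^sup>2 * C * A powr (q / 2 - 1) * t\<^sup>2"
proof -
  define s where "s = sqrt A"
  define u where "u = sqrt C * \<bar>t\<bar>"
  define w where "w = (2 * B * t + C * t\<^sup>2) / A"
  have s: "s > 0" "A = s\<^sup>2" and u: "u \<ge> 0" "C * t\<^sup>2 = u\<^sup>2"
    using AC by (auto simp: s_def u_def power_mult_distrib)
  have Bt: "\<bar>B * t\<bar> \<le> s * u"
    using abs_mult_le_of_square_le[of B A C t] AC by (simp add: s_def u_def)
  have us: "(q + 1) * u \<le> s"
    using small by (simp add: s_def u_def)
  then have us3: "3 * u \<le> s"
    using q u mult_right_mono[of 3 "q + 1" u] by simp
  have Aw: "A * w = 2 * B * t + u\<^sup>2"
    using AC u by (simp add: w_def)
  \<comment> \<open>Reverse triangle inequality; it makes \<open>1 + w\<close> nonnegative, so that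
    the power of the product can be split.\<close>
  have "(s - u)\<^sup>2 \<le> A * (1 + w)"
    using Bt Aw s by (simp add: power2_diff distrib_left abs_le_iff)
  then have w1: "0 \<le> 1 + w"
    using AC by (metis order_trans zero_le_mult_iff not_less zero_le_power2)
  have absw: "\<bar>A * w\<bar> \<le> 2 * s * u + u\<^sup>2"
  proof -
    have "u\<^sup>2 \<ge> 0" by simp
    then show ?thesis unfolding Aw using Bt by linarith
  qed
  \<comment> \<open>The extra 1 in the factor \<open>q + 1\<close> pays for the quadratic part:
    \<open>(q + 1) * u \<le> s\<close> yields both \<open>q * s * u \<le> s\<^sup>2 - s * u\<close>
    and \<open>q * u\<^sup>2 / 2 \<le> s * u\<close>.\<close>
  have pw: "q / 2 * w \<le> 1"
  proof -
    have "q / 2 * (A * w) \<le> q / 2 * (2 * s * u + u\<^sup>2)"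
      using absw q by (intro mult_left_mono) auto
    also have "\<dots> \<le> s\<^sup>2"
    proof -
      have "s * ((q + 1) * u) \<le> s * s" "u * ((q + 1) * u) \<le> u * s"
        using us s u by (auto intro: mult_left_mono)
      then have "q * (s * u) + s * u \<le> s * s" "q * (u * u) + u * u \<le> s * u"
        by (simp_all add: algebra_simps)
      moreover have "u * u \<ge> 0" "s * u \<ge> 0" using s u by auto
      moreover have "q / 2 * (2 * s * u + u\<^sup>2) = q * (s * u) + q * (u * u) / 2"
        by (simp add: algebra_simps power2_eq_square)
      ultimately show ?thesis unfolding power2_eq_square by linarith
    qed
    finally show ?thesis using s by (simp add: field_simps)
  qed
  have "(A + 2 * B * t + C * t\<^sup>2) powr (q / 2) = (A * (1 + w)) powr (q / 2)"
    using Aw u by (simp add: algebra_simps)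
  also have "\<dots> = A powr (q / 2) * (1 + w) powr (q / 2)"
    using AC w1 by (simp add: powr_mult)
  also have "\<dots> \<le> A powr (q / 2) * exp w powr (q / 2)"
    using w1 q by (intro mult_left_mono powr_mono2) (auto simp: exp_ge_add_one_self)
  also have "\<dots> = A powr (q / 2) * exp (q / 2 * w)"
    by (simp add: powr_def)
  also have "\<dots> \<le> A powr (q / 2) * (1 + q / 2 * w + (q / 2 * w)\<^sup>2)"
    using pw by (intro mult_left_mono exp_le_quadratic) auto
  also have "\<dots> = A powr (q / 2) + A powr (q / 2 - 1) * (q / 2 * (A * w) + A * (q / 2 * w)\<^sup>2)"
  proof -
    have "A powr (q / 2) = A powr (q / 2 - 1) * A"
      using AC powr_mult_base[of A "q / 2 - 1"] by (simp add: mult.commute)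
    then show ?thesis by (simp only: distrib_left mult.assoc mult_1_right) (simp add: ac_simps)
  qed
  \<comment> \<open>By \<open>us3\<close>, \<open>2 * s + u \<le> 7 / 3 * s\<close>, hence
    \<open>A * w\<^sup>2 \<le> 49 / 9 * u\<^sup>2\<close>. The coefficient of
    \<open>q\<^sup>2 * u\<^sup>2\<close> is then at most 49/36 + 1/4, which is below 2; the 1/4
    comes from \<open>q \<le> q\<^sup>2 / 2\<close>.\<close>
  also have "\<dots> \<le> A powr (q / 2) + A powr (q / 2 - 1) * (q * (B * t) + 2 * q\<^sup>2 * u\<^sup>2)"
  proof -
    have "(A * w)\<^sup>2 \<le> (2 * s * u + u\<^sup>2)\<^sup>2"
      using absw by (simp add: abs_le_square_iff[symmetric])
    also have "\<dots> = u\<^sup>2 * (2 * s + u)\<^sup>2"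
      by (simp add: algebra_simps power2_eq_square)
    also have "\<dots> \<le> u\<^sup>2 * (7 / 3 * s)\<^sup>2"
      using us3 s u by (intro mult_left_mono power_mono) auto
    finally have "s\<^sup>2 * (s\<^sup>2 * w\<^sup>2) \<le> s\<^sup>2 * (49 / 9 * u\<^sup>2)"
      by (simp add: s power2_eq_square algebra_simps)
    then have "A * w\<^sup>2 \<le> 49 / 9 * u\<^sup>2"
      using s by (simp only: mult_le_cancel_left_pos zero_less_power)
    then have "q\<^sup>2 * (A * w\<^sup>2) \<le> q\<^sup>2 * (49 / 9 * u\<^sup>2)"
      by (intro mult_left_mono) auto
    moreover have "q * u\<^sup>2 \<le> q\<^sup>2 / 2 * u\<^sup>2"
      using q by (intro mult_right_mono) (auto simp: power2_eq_square)
    moreover have "q\<^sup>2 * u\<^sup>2 \<ge> 0" by simp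
    moreover have "q / 2 * (A * w) + A * (q / 2 * w)\<^sup>2
        = q * (B * t) + q * u\<^sup>2 / 2 + q\<^sup>2 * (A * w\<^sup>2) / 4"
      unfolding Aw by (simp add: algebra_simps power2_eq_square)
    ultimately have "q / 2 * (A * w) + A * (q / 2 * w)\<^sup>2 \<le> q * (B * t) + 2 * q\<^sup>2 * u\<^sup>2"
      by linarith
    then show ?thesis by (intro add_left_mono mult_left_mono) auto
  qed
  finally show ?thesis by (simp add: u(2)[symmetric] algebra_simps)
qed

text \<open>Everything is compared with \<open>(2 * q * u) powr q\<close>, where \<open>u\<close> is
  the length of t y: one copy bounds the left side, a second one offsets a negative linear term.
  This is the factor 2.\<close>

lemma powr_quadratic_le_large:
  fixes A B C t q :: real
  assumes q: "q \<ge> 2" and AC: "A \<ge> 0" "C \<ge> 0" "B\<^sup>2 \<le> A * C"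
    and large: "sqrt A \<le> (q + 1) * (sqrt C * \<bar>t\<bar>)"
  shows "(A + 2 * B * t + C * t\<^sup>2) powr (q / 2)
    \<le> A powr (q / 2) + q * B * A powr (q / 2 - 1) * t
       + 2 * (2 * q) powr q * C powr (q / 2) * \<bar>t\<bar> powr q"
proof -
  define s where "s = sqrt A"
  define u where "u = sqrt C * \<bar>t\<bar>"
  have s: "s \<ge> 0" "A = s\<^sup>2" and u: "u \<ge> 0" "C * t\<^sup>2 = u\<^sup>2"
    using AC by (auto simp: s_def u_def power_mult_distrib)
  have Bt: "\<bar>B * t\<bar> \<le> s * u"
    using abs_mult_le_of_square_le[of B A C t] AC by (simp add: s_def u_def)
  have su: "s \<le> (q + 1) * u"
    using large by (simp add: s_def u_def)
  have Ap: "A powr (q / 2) = s powr q" "A powr (q / 2 - 1) = s powr (q - 2)"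
    using square_powr_half[OF s(1), of q] square_powr_half[OF s(1), of "q - 2"]
    by (simp_all add: s(2) diff_divide_distrib)
  have up: "C powr (q / 2) * \<bar>t\<bar> powr q = u powr q"
    using AC square_powr_half[of "sqrt C" q] by (simp add: u_def powr_mult)
  have pos: "0 \<le> A + 2 * B * t + C * t\<^sup>2"
  proof -
    have "(s - u)\<^sup>2 \<le> A + 2 * B * t + C * t\<^sup>2"
      using Bt s u by (simp add: power2_diff abs_le_iff)
    then show ?thesis by (meson order_trans zero_le_power2)
  qed
  have "A + 2 * B * t + C * t\<^sup>2 \<le> (s + u)\<^sup>2"
    using Bt s u by (simp add: power2_sum abs_le_iff)
  \<comment> \<open>\<open>s + u \<le> (q + 2) * u \<le> 2 * q * u\<close>, because
    \<open>q \<ge> 2\<close>.\<close>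
  also have "\<dots> \<le> (2 * q * u)\<^sup>2"
    using su s u q mult_right_mono[of 2 q u] by (intro power_mono) (auto simp: algebra_simps)
  finally have "(A + 2 * B * t + C * t\<^sup>2) powr (q / 2) \<le> ((2 * q * u)\<^sup>2) powr (q / 2)"
    using pos q by (intro powr_mono2) auto
  also have "\<dots> = (2 * q) powr q * u powr q"
    using q u by (simp add: square_powr_half powr_mult)
  finally have upper: "(A + 2 * B * t + C * t\<^sup>2) powr (q / 2) \<le> (2 * q) powr q * u powr q" .
  have lower: "- ((2 * q) powr q * u powr q) \<le> s powr q + q * (B * t) * s powr (q - 2)"
  proof -
    have sq: "s * s powr (q - 2) = s powr (q - 1)" "s * s powr (q - 1) = s powr q"
      using s q powr_mult_base[of s "q - 2"] powr_mult_base[of s "q - 1"] by simp_all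
    have uq: "q * u * (q * u) powr (q - 1) = (q * u) powr q"
      using u q powr_mult_base[of "q * u" "q - 1"] by simp
    have "- (q * (B * t) * s powr (q - 2)) \<le> q * (s * u) * s powr (q - 2)"
    proof -
      have "q * (- (B * t)) * s powr (q - 2) \<le> q * (s * u) * s powr (q - 2)"
        using Bt q by (intro mult_right_mono mult_left_mono) auto
      then show ?thesis by simp
    qed
    also have "\<dots> = q * u * s powr (q - 1)"
      by (simp flip: sq(1))
    \<comment> \<open>The product is at most the \<open>q\<close>-th power of the larger of
      \<open>s\<close> and \<open>q * u\<close>.\<close>
    also have "\<dots> \<le> s powr q + (q * u) powr q"
    proof (cases "q * u \<le> s")
      case True
      then have "q * u * s powr (q - 1) \<le> s * s powr (q - 1)"
        by (intro mult_right_mono) auto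
      then show ?thesis unfolding sq(2) by (simp add: add_increasing2)
    next
      case False
      then have "q * u * s powr (q - 1) \<le> q * u * (q * u) powr (q - 1)"
        using s u q by (intro mult_left_mono powr_mono2) auto
      then show ?thesis unfolding uq by (simp add: add_increasing)
    qed
    also have "(q * u) powr q \<le> (2 * q * u) powr q"
      using q u by (intro powr_mono2) (auto simp: mult_right_mono)
    also have "\<dots> = (2 * q) powr q * u powr q"
      using q u by (simp add: powr_mult)
    finally show ?thesis by simp
  qed
  have "2 * (2 * q) powr q * C powr (q / 2) * \<bar>t\<bar> powr q = 2 * (2 * q) powr q * u powr q"
    using up by (simp only: mult.assoc)
  moreover have "q * B * s powr (q - 2) * t = q * (B * t) * s powr (q - 2)"
    by simp
  ultimately show ?thesis
    using upper lower unfolding Ap by linarith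
qed

text \<open>
  The expression \<open>A + 2 * B * t + C * t\<^sup>2\<close> with \<open>B\<^sup>2 \<le> A * C\<close> stands for \<open>\<bar>x + t y\<bar>\<^sup>2\<close>, where
  \<open>x\<close> and \<open>y\<close> are vectors of a Euclidean space.
\<close>

lemma powr_quadratic_le:
  fixes A B C t q :: real
  assumes q: "q \<ge> 2" and AC: "A \<ge> 0" "C \<ge> 0" "B\<^sup>2 \<le> A * C"
  shows "(A + 2 * B * t + C * t\<^sup>2) powr (q / 2)
    \<le> A powr (q / 2) + q * B * A powr (q / 2 - 1) * t
       + 2 * q\<^sup>2 * C * A powr (q / 2 - 1) * t\<^sup>2
       + 2 * (2 * q) powr q * C powr (q / 2) * \<bar>t\<bar> powr q"
proof (cases "A > 0 \<and> (q + 1) * (sqrt C * \<bar>t\<bar>) \<le> sqrt A")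
  case True
  have "0 \<le> 2 * (2 * q) powr q * C powr (q / 2) * \<bar>t\<bar> powr q"
    by simp
  with True powr_quadratic_le_small[of q A C B t] q AC show ?thesis
    by linarith
next
  case False
  \<comment> \<open>A vanishing \<open>A\<close> is treated here as well, since the small case
    divides by \<open>A\<close>.\<close>
  then have "sqrt A \<le> (q + 1) * (sqrt C * \<bar>t\<bar>)"
    using AC q by (cases "A = 0") auto
  from powr_quadratic_le_large[OF q AC this]
  moreover have "0 \<le> 2 * q\<^sup>2 * C * A powr (q / 2 - 1) * t\<^sup>2"
    using AC by simp
  ultimately show ?thesis by linarith
qed

section \<open>The inequality for one random variable\<close>

text \<open>A property of the law, so that it can be imposed on the factors of a product measure.
  Integrability of the \<open>q\<close>-th power is explicit because the Bochner integral of a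
  non-integrable function is 0, which would make the moment bound void.\<close>

definition standardized :: "real \<Rightarrow> real \<Rightarrow> real measure \<Rightarrow> bool"
  where "standardized q \<sigma> \<mu> \<longleftrightarrow> (\<integral>z. z \<partial>\<mu>) = 0 \<and> (\<integral>z. z\<^sup>2 \<partial>\<mu>) = 1
    \<and> integrable \<mu> (\<lambda>z. \<bar>z\<bar> powr q) \<and> (\<integral>z. \<bar>z\<bar> powr q \<partial>\<mu>) \<le> \<sigma> powr (2 - q)"

text \<open>Both follow from
  \<open>2 * q * \<bar>\<rho>\<bar> \<le> 1 / sqrt q \<le> 1 / sqrt 2\<close>. The first bound
  shrinks \<open>2 * q\<^sup>2 * \<rho>\<^sup>2\<close> to \<open>q / 2\<close>, the tangent slope
  in \<open>add_powr_ge\<close>; the second cancels the constant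
  \<open>2 * (2 * q) powr q\<close>.\<close>

lemma noise_rate_bounds:
  fixes q \<rho> :: real
  assumes q: "q \<ge> 2" and \<rho>: "\<bar>\<rho>\<bar> < 1 / (2 * q powr (3 / 2))"
  shows "4 * q * \<rho>\<^sup>2 \<le> 1" "2 * (2 * q * \<bar>\<rho>\<bar>) powr q \<le> 1"
proof -
  have "q powr (3 / 2) = q * q powr (1 / 2)"
    using q powr_mult_base[of q "1 / 2"] by simp
  then have q32: "q powr (3 / 2) = q * sqrt q"
    using q by (simp add: powr_half_sqrt)
  have "2 * q * \<bar>\<rho>\<bar> \<le> 2 * q * (1 / (2 * q powr (3 / 2)))"
    using q \<rho> by (intro mult_left_mono) auto
  also have "\<dots> = 1 / sqrt q"
    unfolding q32 using q by simp
  also have "\<dots> \<le> 1 / sqrt 2"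
    using q by (intro divide_left_mono) auto
  finally have le: "2 * q * \<bar>\<rho>\<bar> \<le> 1 / sqrt 2" .
  then have "(2 * q * \<bar>\<rho>\<bar>)\<^sup>2 \<le> (1 / sqrt 2)\<^sup>2"
    using q by (intro power_mono) auto
  then have "8 * (q\<^sup>2 * \<rho>\<^sup>2) \<le> 1"
    by (simp add: power_mult_distrib power_divide)
  moreover have "q * \<rho>\<^sup>2 \<le> q\<^sup>2 * \<rho>\<^sup>2"
    using q by (intro mult_right_mono) (auto simp: power2_eq_square)
  moreover have "0 \<le> q\<^sup>2 * \<rho>\<^sup>2" by simp
  ultimately show "4 * q * \<rho>\<^sup>2 \<le> 1"
    by linarith
  have "(2 * q * \<bar>\<rho>\<bar>) powr q \<le> (1 / sqrt 2) powr q"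
    using q le by (intro powr_mono2) auto
  also have "\<dots> \<le> (1 / sqrt 2) powr 2"
    using q by (intro powr_mono') auto
  also have "\<dots> = 1 / 2"
    by (simp add: power_divide)
  finally show "2 * (2 * q * \<bar>\<rho>\<bar>) powr q \<le> 1" by simp
qed

text \<open>This integrates \<open>powr_quadratic_le\<close> at \<open>t = \<rho> * z\<close>; the
  terms of order at most two reduce to the tangent bounded by \<open>add_powr_ge\<close>. The
  nonnegative integral is the form to which Tonelli's theorem applies in the induction.\<close>

lemma nn_integral_powr_quadratic_le:
  fixes \<mu> :: "real measure" and A B C q \<rho> \<sigma> :: real
  assumes "prob_space \<mu>" and sets[measurable_cong]: "sets \<mu> = sets borel"
    and std: "standardized q \<sigma> \<mu>"
    and q: "q \<ge> 2" and \<rho>: "\<bar>\<rho>\<bar> < 1 / (2 * q powr (3 / 2))"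
    and AC: "A \<ge> 0" "C \<ge> 0" "B\<^sup>2 \<le> A * C"
  shows "(\<integral>\<^sup>+z. ennreal ((A + 2 * B * (\<rho> * z) + C * (\<rho> * z)\<^sup>2) powr (q / 2)) \<partial>\<mu>)
    \<le> ennreal ((A + C) powr (q / 2) + \<sigma> powr (2 - q) * C powr (q / 2))"
proof -
  interpret prob_space \<mu> by fact
  define D where "D = A powr (q / 2 - 1)"
  define L where "L = 2 * (2 * q) powr q * C powr (q / 2) * \<bar>\<rho>\<bar> powr q"
  define g where "g z = A powr (q / 2) + q * B * D * \<rho> * z + 2 * q\<^sup>2 * C * D * \<rho>\<^sup>2 * z\<^sup>2
    + L * \<bar>z\<bar> powr q" for z
  \<comment> \<open>A non-integrable square would have integral 0, not 1.\<close>
  have i2: "integrable \<mu> (\<lambda>z. z\<^sup>2)"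
    using std not_integrable_integral_eq[of \<mu> "\<lambda>z. z\<^sup>2"] by (auto simp: standardized_def)
  have i1: "integrable \<mu> (\<lambda>z. z)"
    by (rule square_integrable_imp_integrable[OF _ i2]) simp
  have iq: "integrable \<mu> (\<lambda>z. \<bar>z\<bar> powr q)"
    using std by (simp add: standardized_def)
  have le_g: "(A + 2 * B * (\<rho> * z) + C * (\<rho> * z)\<^sup>2) powr (q / 2) \<le> g z" for z
    using powr_quadratic_le[OF q AC, of "\<rho> * z"]
    by (simp add: g_def D_def L_def abs_mult powr_mult power_mult_distrib mult.assoc)
  have ig: "integrable \<mu> g"
    unfolding g_def using i1 i2 iq by simp
  have "(\<integral>z. g z \<partial>\<mu>) = A powr (q / 2) + 2 * q\<^sup>2 * C * D * \<rho>\<^sup>2 + L * (\<integral>z. \<bar>z\<bar> powr q \<partial>\<mu>)"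
    unfolding g_def using i1 i2 iq std by (simp add: standardized_def prob_space)
  also have "\<dots> \<le> (A powr (q / 2) + q / 2 * C * D) + \<sigma> powr (2 - q) * C powr (q / 2)"
  proof -
    have "q * C * D * (4 * q * \<rho>\<^sup>2) \<le> q * C * D * 1"
      using noise_rate_bounds(1)[OF q \<rho>] q AC by (intro mult_left_mono) (auto simp: D_def)
    then have 1: "2 * q\<^sup>2 * C * D * \<rho>\<^sup>2 \<le> q / 2 * C * D"
      by (simp add: power2_eq_square algebra_simps)
    have "L = 2 * (2 * q * \<bar>\<rho>\<bar>) powr q * C powr (q / 2)"
      using q by (simp add: L_def powr_mult)
    also have "\<dots> \<le> 1 * C powr (q / 2)"
      using noise_rate_bounds(2)[OF q \<rho>] by (intro mult_right_mono) auto
    finally have "L * (\<integral>z. \<bar>z\<bar> powr q \<partial>\<mu>) \<le> C powr (q / 2) * \<sigma> powr (2 - q)"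
      using std by (intro mult_mono) (auto simp: standardized_def)
    with 1 show ?thesis by (simp add: mult.commute)
  qed
  also have "\<dots> \<le> (A + C) powr (q / 2) + \<sigma> powr (2 - q) * C powr (q / 2)"
    using add_powr_ge[of "q / 2" A C] q AC by (simp add: D_def)
  finally have int_g: "(\<integral>z. g z \<partial>\<mu>) \<le> (A + C) powr (q / 2) + \<sigma> powr (2 - q) * C powr (q / 2)" .
  have "(\<integral>\<^sup>+z. ennreal ((A + 2 * B * (\<rho> * z) + C * (\<rho> * z)\<^sup>2) powr (q / 2)) \<partial>\<mu>)
    \<le> (\<integral>\<^sup>+z. ennreal (g z) \<partial>\<mu>)"
    by (intro nn_integral_mono ennreal_leI le_g)
  \<comment> \<open>\<open>g\<close> is nonnegative because it dominates a power.\<close>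
  also have "\<dots> = ennreal (\<integral>z. g z \<partial>\<mu>)"
    using order_trans[OF powr_ge_zero le_g] by (intro nn_integral_eq_integral ig) auto
  also have "\<dots> \<le> ennreal ((A + C) powr (q / 2) + \<sigma> powr (2 - q) * C powr (q / 2))"
    by (intro ennreal_leI int_g)
  finally show ?thesis .
qed

section \<open>Polynomials on a product space and the induction over the variables\<close>

lemma sum_Pow_insert:
  fixes f :: "'i set \<Rightarrow> 'b::comm_monoid_add"
  assumes "finite I" "i \<notin> I"
  shows "(\<Sum>S\<in>Pow (insert i I). f S) = (\<Sum>S\<in>Pow I. f S) + (\<Sum>S\<in>Pow I. f (insert i S))"
proof -
  have "inj_on (insert i) (Pow I)"
    using assms(2) by (auto intro!: inj_onI)
  moreover have "Pow I \<inter> insert i ` Pow I = {}"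
    using assms(2) by auto
  ultimately show ?thesis
    using assms(1) by (simp add: Pow_insert sum.union_disjoint sum.reindex)
qed

lemma sum_lessThan_add:
  fixes f :: "nat \<Rightarrow> 'b::comm_monoid_add"
  shows "(\<Sum>j<m + k. f j) = (\<Sum>j<m. f j) + (\<Sum>j<k. f (m + j))"
  by (induction k) (simp_all add: add.assoc)

text \<open>The value of the noise operator at the point \<open>z\<close>; the arbitrary index set
  allows the variables to be removed one by one.\<close>

definition chaos :: "'i set \<Rightarrow> real \<Rightarrow> ('i set \<Rightarrow> real) \<Rightarrow> ('i \<Rightarrow> real) \<Rightarrow> real"
  where "chaos I \<rho> c z = (\<Sum>S\<in>Pow I. \<rho> ^ card S * c S * (\<Prod>i\<in>S. z i))"

text \<open>The algebraic form of the squared L2 norm of the derivative at \<open>S\<close>, which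
  the induction can handle without integration.\<close>

definition energy :: "'i set \<Rightarrow> ('i set \<Rightarrow> real) \<Rightarrow> 'i set \<Rightarrow> real"
  where "energy I c S = (\<Sum>T\<in>{T \<in> Pow I. S \<subseteq> T}. (c T)\<^sup>2)"

lemma energy_nonneg: "0 \<le> energy I c S"
  by (simp add: energy_def sum_nonneg)

text \<open>Sets containing \<open>i\<close> carry one more factor \<open>\<rho> * y\<close>, so the
  polynomial is affine in coordinate \<open>i\<close>. The point \<open>z(i := y)\<close> is the
  form in which the product integral separates that coordinate.\<close>

lemma chaos_insert:
  assumes I: "finite I" "i \<notin> I"
  shows "chaos (insert i I) \<rho> c (z(i := y))
    = chaos I \<rho> c z + \<rho> * y * chaos I \<rho> (\<lambda>S. c (insert i S)) z"
proof -
  have S: "(\<Prod>j\<in>S. (z(i := y)) j) = (\<Prod>j\<in>S. z j)" "finite S" "i \<notin> S" if "S \<in> Pow I" for S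
    using that I finite_subset[of S I] by (auto intro!: prod.cong)
  have "(\<Sum>S\<in>Pow I. \<rho> ^ card S * c S * (\<Prod>j\<in>S. (z(i := y)) j)) = chaos I \<rho> c z"
    unfolding chaos_def by (intro sum.cong refl) (simp only: S)
  moreover have "(\<Sum>S\<in>Pow I. \<rho> ^ card (insert i S) * c (insert i S) * (\<Prod>j\<in>insert i S. (z(i := y)) j))
      = \<rho> * y * chaos I \<rho> (\<lambda>S. c (insert i S)) z"
    unfolding chaos_def sum_distrib_left
  proof (intro sum.cong refl)
    fix S assume "S \<in> Pow I"
    note S = S[OF this]
    have "(\<Prod>j\<in>insert i S. (z(i := y)) j) = y * (\<Prod>j\<in>S. z j)"
      by (simp only: prod.insert[OF S(2,3)] fun_upd_same S(1))
    with S show "\<rho> ^ card (insert i S) * c (insert i S) * (\<Prod>j\<in>insert i S. (z(i := y)) j)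
      = \<rho> * y * (\<rho> ^ card S * c (insert i S) * (\<Prod>j\<in>S. z j))"
      by (simp only: card_insert_disjoint[OF S(2,3)] power_Suc mult_ac)
  qed
  ultimately show ?thesis
    unfolding chaos_def[of "insert i I"] sum_Pow_insert[OF I] by simp
qed

text \<open>The sets \<open>T\<close> are sorted by whether they contain \<open>i\<close>. Read
  backwards, this is how the two terms of an induction step recombine: the energies of g and h add
  up at sets without \<open>i\<close>, and the energy of h alone belongs to sets with
  \<open>i\<close>.\<close>

lemma energy_insert:
  assumes I: "finite I" "i \<notin> I" and S: "S \<subseteq> I"
  shows "energy (insert i I) c S = energy I c S + energy I (\<lambda>T. c (insert i T)) S"
    and "energy (insert i I) c (insert i S) = energy I (\<lambda>T. c (insert i T)) S"
proof -
  have eq: "energy J d U = (\<Sum>T\<in>Pow J. if U \<subseteq> T then (d T)\<^sup>2 else 0)" if "finite J" for J d and U :: "'a set"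
    unfolding energy_def using that by (intro sum.inter_filter) simp
  have *: "S \<subseteq> insert i T \<longleftrightarrow> S \<subseteq> T" "insert i S \<subseteq> insert i T \<longleftrightarrow> S \<subseteq> T"
      "\<not> insert i S \<subseteq> T" if "T \<in> Pow I" for T
    using that I S by auto
  have "(\<Sum>T\<in>Pow I. if S \<subseteq> insert i T then (c (insert i T))\<^sup>2 else 0)
      = (\<Sum>T\<in>Pow I. if S \<subseteq> T then (c (insert i T))\<^sup>2 else 0)"
    by (intro sum.cong refl) (simp only: *)
  then show "energy (insert i I) c S = energy I c S + energy I (\<lambda>T. c (insert i T)) S"
    using I by (simp add: eq sum_Pow_insert)
  have "(\<Sum>T\<in>Pow I. if insert i S \<subseteq> T then (c T)\<^sup>2 else 0) = 0"
    by (intro sum.neutral ballI) (simp only: * if_False)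
  moreover have "(\<Sum>T\<in>Pow I. if insert i S \<subseteq> insert i T then (c (insert i T))\<^sup>2 else 0)
      = (\<Sum>T\<in>Pow I. if S \<subseteq> T then (c (insert i T))\<^sup>2 else 0)"
    by (intro sum.cong refl) (simp only: *)
  ultimately show "energy (insert i I) c (insert i S) = energy I (\<lambda>T. c (insert i T)) S"
    using I(1) by (simp only: eq sum_Pow_insert[OF I] finite_insert add_0)
qed

lemma borel_measurable_chaos:
  assumes "\<And>i. i \<in> I \<Longrightarrow> sets (\<mu> i) = sets borel"
  shows "chaos I \<rho> c \<in> borel_measurable (PiM I \<mu>)"
proof -
  have "(\<lambda>z. z i) \<in> borel_measurable (PiM I \<mu>)" if "i \<in> I" for i
    using measurable_component_singleton[OF that, of \<mu>] measurable_cong_sets[OF refl assms[OF that]] by blast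
  then show ?thesis
    unfolding chaos_def
    by (intro borel_measurable_sum borel_measurable_times borel_measurable_prod) auto
qed

text \<open>
  The induction is over the set of variables and needs the statement for vectors of polynomials:
  each step replaces a vector \<open>g + z\<^sub>i h\<close> by the concatenation \<open>(g, h)\<close> and doubles its length.
\<close>

lemma nn_integral_chaos_le:
  fixes \<mu> :: "'i \<Rightarrow> real measure" and b :: "nat \<Rightarrow> 'i set \<Rightarrow> real" and q \<rho> \<sigma> :: real
  assumes prob: "\<And>i. prob_space (\<mu> i)" and sets: "\<And>i. sets (\<mu> i) = sets borel"
    and q: "q \<ge> 2" and "\<sigma> > 0" and \<rho>: "\<bar>\<rho>\<bar> < 1 / (2 * q powr (3 / 2))"
    and "finite I" and "\<And>i. i \<in> I \<Longrightarrow> standardized q \<sigma> (\<mu> i)"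
  shows "(\<integral>\<^sup>+z. ennreal ((\<Sum>j<m. (chaos I \<rho> (b j) z)\<^sup>2) powr (q / 2)) \<partial>PiM I \<mu>)
    \<le> ennreal (\<Sum>S\<in>Pow I. \<sigma> powr ((2 - q) * card S) * (\<Sum>j<m. energy I (b j) S) powr (q / 2))"
  using assms(6,7)
proof (induction I arbitrary: m b rule: finite_induct)
  interpret product_sigma_finite \<mu>
    by (intro product_sigma_finite.intro prob_space_imp_sigma_finite prob)
  case empty
  have "{T \<in> Pow {}. {} \<subseteq> T} = {{} :: 'i set}" by auto
  \<comment> \<open>Only \<open>S = {}\<close> is left, with weight
    \<open>\<sigma> powr 0 = 1\<close>, and both sides agree.\<close>
  then show ?case
    using \<open>\<sigma> > 0\<close> by (simp add: chaos_def energy_def PiM_empty)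
next
  interpret product_sigma_finite \<mu>
    by (intro product_sigma_finite.intro prob_space_imp_sigma_finite prob)
  case (insert i I)
  note I = \<open>finite I\<close> \<open>i \<notin> I\<close>
  \<comment> \<open>\<open>h j\<close> holds the coefficients of the factor of \<open>z i\<close>;
    \<open>d\<close> is the concatenated vector of length \<open>m + m\<close>.\<close>
  define h where "h j S = b j (insert i S)" for j S
  define d where "d j = (if j < m then b j else h (j - m))" for j
  have sum_d: "(\<Sum>j<m + m. F (d j)) = (\<Sum>j<m. F (b j)) + (\<Sum>j<m. F (h j))"
    for F :: "('i set \<Rightarrow> real) \<Rightarrow> real"
    unfolding sum_lessThan_add by (simp add: d_def)
  note [measurable] = borel_measurable_chaos[of _ \<mu>, OF sets]
  let ?s = "\<sigma> powr (2 - q)"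
  have inner: "(\<integral>\<^sup>+y. ennreal ((\<Sum>j<m. (chaos (insert i I) \<rho> (b j) (z(i := y)))\<^sup>2) powr (q / 2)) \<partial>\<mu> i)
    \<le> ennreal ((\<Sum>j<m + m. (chaos I \<rho> (d j) z)\<^sup>2) powr (q / 2))
       + ennreal ?s * ennreal ((\<Sum>j<m. (chaos I \<rho> (h j) z)\<^sup>2) powr (q / 2))" for z
  proof -
    define A where "A = (\<Sum>j<m. (chaos I \<rho> (b j) z)\<^sup>2)"
    define B where "B = (\<Sum>j<m. chaos I \<rho> (b j) z * chaos I \<rho> (h j) z)"
    define C where "C = (\<Sum>j<m. (chaos I \<rho> (h j) z)\<^sup>2)"
    have AC: "A \<ge> 0" "C \<ge> 0" "B\<^sup>2 \<le> A * C"
      using Cauchy_Schwarz_ineq_sum[of "\<lambda>j. chaos I \<rho> (b j) z" "\<lambda>j. chaos I \<rho> (h j) z" "{..<m}"]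
      by (auto simp: A_def B_def C_def sum_nonneg)
    have "(\<Sum>j<m. (chaos (insert i I) \<rho> (b j) (z(i := y)))\<^sup>2)
      = A + 2 * B * (\<rho> * y) + C * (\<rho> * y)\<^sup>2" for y
    proof -
      have "chaos (insert i I) \<rho> (b j) (z(i := y)) = chaos I \<rho> (b j) z + \<rho> * y * chaos I \<rho> (h j) z" for j
        using chaos_insert[OF I] by (simp add: h_def[abs_def])
      then show ?thesis
        by (simp add: A_def B_def C_def power2_sum power_mult_distrib sum.distrib
            sum_distrib_left sum_distrib_right mult_ac)
    qed
    then have "(\<integral>\<^sup>+y. ennreal ((\<Sum>j<m. (chaos (insert i I) \<rho> (b j) (z(i := y)))\<^sup>2) powr (q / 2)) \<partial>\<mu> i)
      \<le> ennreal ((A + C) powr (q / 2) + ?s * C powr (q / 2))"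
      using nn_integral_powr_quadratic_le[OF prob sets insert.prems q \<rho> AC] by simp
    also have "\<dots> = ennreal ((A + C) powr (q / 2)) + ennreal ?s * ennreal (C powr (q / 2))"
      by (simp add: ennreal_mult)
    also have "A + C = (\<Sum>j<m + m. (chaos I \<rho> (d j) z)\<^sup>2)"
      using sum_d[of "\<lambda>c. (chaos I \<rho> c z)\<^sup>2"] by (simp add: A_def C_def)
    finally show ?thesis unfolding C_def .
  qed
  let ?w = "\<lambda>S. \<sigma> powr ((2 - q) * card S)"
  \<comment> \<open>Coordinate \<open>i\<close> is integrated first with the others frozen, so that
    \<open>inner\<close> applies.\<close>
  have "(\<integral>\<^sup>+z. ennreal ((\<Sum>j<m. (chaos (insert i I) \<rho> (b j) z)\<^sup>2) powr (q / 2)) \<partial>PiM (insert i I) \<mu>)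
    = (\<integral>\<^sup>+z. (\<integral>\<^sup>+y. ennreal ((\<Sum>j<m. (chaos (insert i I) \<rho> (b j) (z(i := y)))\<^sup>2) powr (q / 2)) \<partial>\<mu> i) \<partial>PiM I \<mu>)"
    by (rule product_nn_integral_insert[OF I]) measurable
  also have "\<dots> \<le> (\<integral>\<^sup>+z. ennreal ((\<Sum>j<m + m. (chaos I \<rho> (d j) z)\<^sup>2) powr (q / 2))
       + ennreal ?s * ennreal ((\<Sum>j<m. (chaos I \<rho> (h j) z)\<^sup>2) powr (q / 2)) \<partial>PiM I \<mu>)"
    by (intro nn_integral_mono inner)
  also have "\<dots> = (\<integral>\<^sup>+z. ennreal ((\<Sum>j<m + m. (chaos I \<rho> (d j) z)\<^sup>2) powr (q / 2)) \<partial>PiM I \<mu>)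
       + ennreal ?s * (\<integral>\<^sup>+z. ennreal ((\<Sum>j<m. (chaos I \<rho> (h j) z)\<^sup>2) powr (q / 2)) \<partial>PiM I \<mu>)"
    by (subst nn_integral_add; (subst nn_integral_cmult)?) measurable
  \<comment> \<open>The induction hypothesis serves twice, for the long vector \<open>d\<close> and
    for \<open>h\<close> alone; hence \<open>m\<close> and \<open>b\<close> are generalized.\<close>
  also have "\<dots> \<le> ennreal (\<Sum>S\<in>Pow I. ?w S * (\<Sum>j<m + m. energy I (d j) S) powr (q / 2))
       + ennreal ?s * ennreal (\<Sum>S\<in>Pow I. ?w S * (\<Sum>j<m. energy I (h j) S) powr (q / 2))"
    using insert.prems by (intro add_mono mult_left_mono insert.IH) auto
  also have "\<dots> = ennreal ((\<Sum>S\<in>Pow I. ?w S * (\<Sum>j<m + m. energy I (d j) S) powr (q / 2))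
       + ?s * (\<Sum>S\<in>Pow I. ?w S * (\<Sum>j<m. energy I (h j) S) powr (q / 2)))"
    by (simp add: ennreal_mult sum_nonneg)
  also have "(\<Sum>S\<in>Pow I. ?w S * (\<Sum>j<m + m. energy I (d j) S) powr (q / 2))
    = (\<Sum>S\<in>Pow I. ?w S * (\<Sum>j<m. energy (insert i I) (b j) S) powr (q / 2))"
  proof (intro sum.cong refl)
    fix S assume "S \<in> Pow I"
    then show "?w S * (\<Sum>j<m + m. energy I (d j) S) powr (q / 2)
      = ?w S * (\<Sum>j<m. energy (insert i I) (b j) S) powr (q / 2)"
      using sum_d[of "\<lambda>c. energy I c S"] energy_insert(1)[OF I]
      by (simp add: sum.distrib h_def[abs_def])
  qed
  \<comment> \<open>The factor \<open>\<sigma> powr (2 - q)\<close> is the weight of the additional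
    element \<open>i\<close>.\<close>
  also have "?s * (\<Sum>S\<in>Pow I. ?w S * (\<Sum>j<m. energy I (h j) S) powr (q / 2))
    = (\<Sum>S\<in>Pow I. ?w (insert i S) * (\<Sum>j<m. energy (insert i I) (b j) (insert i S)) powr (q / 2))"
    unfolding sum_distrib_left
  proof (intro sum.cong refl)
    fix S assume S: "S \<in> Pow I"
    then have "card (insert i S) = Suc (card S)"
      using I finite_subset[of S I] by (intro card_insert_disjoint) auto
    then have "?w (insert i S) = ?s * ?w S"
      by (simp add: algebra_simps flip: powr_add)
    then show "?s * (?w S * (\<Sum>j<m. energy I (h j) S) powr (q / 2))
      = ?w (insert i S) * (\<Sum>j<m. energy (insert i I) (b j) (insert i S)) powr (q / 2)"
      using S energy_insert(2)[OF I] by (simp add: h_def[abs_def])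
  qed
  finally show ?case
    unfolding sum_Pow_insert[OF I] .
qed

section \<open>Independent variables: orthonormal monomials and transfer from the product
  space\<close>

context prob_space
begin

text \<open>Each variable enters with exponent \<open>e i\<close> in {0, 1, 2}, and independence
  factors the expectation. Exponent 1 gives the factor 0 and occurs exactly on the symmetric
  difference of \<open>U\<close> and \<open>V\<close>; the other exponents give 1.\<close>

lemma expectation_prod_mult_prod:
  fixes Z :: "'i \<Rightarrow> 'a \<Rightarrow> real"
  assumes "finite I" and indep: "indep_vars (\<lambda>_. borel) Z I"
    and mean: "\<And>i. i \<in> I \<Longrightarrow> expectation (Z i) = 0"
    and var: "\<And>i. i \<in> I \<Longrightarrow> expectation (\<lambda>\<omega>. (Z i \<omega>)\<^sup>2) = 1"
    and UV: "U \<subseteq> I" "V \<subseteq> I"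
  shows "integrable M (\<lambda>\<omega>. (\<Prod>i\<in>U. Z i \<omega>) * (\<Prod>i\<in>V. Z i \<omega>))"
    and "expectation (\<lambda>\<omega>. (\<Prod>i\<in>U. Z i \<omega>) * (\<Prod>i\<in>V. Z i \<omega>)) = of_bool (U = V)"
proof -
  define e :: "'i \<Rightarrow> nat" where "e i = of_bool (i \<in> U) + of_bool (i \<in> V)" for i
  have prod_eq: "(\<Prod>i\<in>U. x i) * (\<Prod>i\<in>V. x i) = (\<Prod>i\<in>I. x i ^ e i)" for x :: "'i \<Rightarrow> real"
  proof -
    have "(\<Prod>i\<in>W. x i) = (\<Prod>i\<in>I. x i ^ of_bool (i \<in> W))" if "W \<subseteq> I" for W
      using that \<open>finite I\<close> by (intro prod.mono_neutral_cong_left) auto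
    then show ?thesis
      using UV by (simp add: e_def power_add prod.distrib)
  qed
  have e: "e i = 0 \<or> e i = 1 \<or> e i = 2" for i
    by (auto simp: e_def)
  have meas: "random_variable borel (Z i)" if "i \<in> I" for i
    using indep that by (auto simp: indep_vars_def)
  have int2: "integrable M (\<lambda>\<omega>. (Z i \<omega>)\<^sup>2)" if "i \<in> I" for i
    using var[OF that] not_integrable_integral_eq[of M "\<lambda>\<omega>. (Z i \<omega>)\<^sup>2"] by auto
  have int1: "integrable M (Z i)" if "i \<in> I" for i
    using square_integrable_imp_integrable[OF meas int2] that by blast
  have int: "integrable M (\<lambda>\<omega>. Z i \<omega> ^ e i)" if "i \<in> I" for i
    using e[of i] int1[OF that] int2[OF that] by auto
  have ex: "expectation (\<lambda>\<omega>. Z i \<omega> ^ e i) = of_bool (e i \<noteq> 1)" if "i \<in> I" for i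
    using e[of i] mean[OF that] var[OF that] by (auto simp: prob_space)
  have ind: "indep_vars (\<lambda>_. borel) (\<lambda>i \<omega>. Z i \<omega> ^ e i) I"
    by (rule indep_vars_compose2[OF indep]) simp
  show "integrable M (\<lambda>\<omega>. (\<Prod>i\<in>U. Z i \<omega>) * (\<Prod>i\<in>V. Z i \<omega>))"
    unfolding prod_eq by (rule indep_vars_integrable[OF \<open>finite I\<close> ind int])
  have "expectation (\<lambda>\<omega>. (\<Prod>i\<in>U. Z i \<omega>) * (\<Prod>i\<in>V. Z i \<omega>)) = (\<Prod>i\<in>I. expectation (\<lambda>\<omega>. Z i \<omega> ^ e i))"
    unfolding prod_eq by (rule indep_vars_lebesgue_integral[OF \<open>finite I\<close> ind int])
  also have "\<dots> = (\<Prod>i\<in>I. of_bool (e i \<noteq> 1))"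
    using ex by (intro prod.cong) auto
  also have "\<dots> = of_bool (U = V)"
  proof (cases "U = V")
    case True
    then show ?thesis by (auto simp: e_def intro!: prod.neutral)
  next
    case False
    then obtain i where "i \<in> I" "i \<in> U \<longleftrightarrow> i \<notin> V" using UV by blast
    then have "i \<in> I" "e i = 1" by (auto simp: e_def)
    then have "(\<Prod>i\<in>I. of_bool (e i \<noteq> 1)) = (0 :: real)"
      using \<open>finite I\<close> by (intro prod_zero) auto
    with False show ?thesis by simp
  qed
  finally show "expectation (\<lambda>\<omega>. (\<Prod>i\<in>U. Z i \<omega>) * (\<Prod>i\<in>V. Z i \<omega>)) = of_bool (U = V)" .
qed

text \<open>Parseval's identity. The injective indexing \<open>h\<close> is there for derivatives,
  whose coefficients are indexed by sets \<open>T\<close> but whose monomials run over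
  \<open>T - S\<close>.\<close>

lemma expectation_sum_prod_square:
  fixes Z :: "'i \<Rightarrow> 'a \<Rightarrow> real" and c :: "'k \<Rightarrow> real" and h :: "'k \<Rightarrow> 'i set"
  assumes "finite I" and indep: "indep_vars (\<lambda>_. borel) Z I"
    and mean: "\<And>i. i \<in> I \<Longrightarrow> expectation (Z i) = 0"
    and var: "\<And>i. i \<in> I \<Longrightarrow> expectation (\<lambda>\<omega>. (Z i \<omega>)\<^sup>2) = 1"
    and "finite F" "inj_on h F" "h ` F \<subseteq> Pow I"
  shows "expectation (\<lambda>\<omega>. (\<Sum>k\<in>F. c k * (\<Prod>i\<in>h k. Z i \<omega>))\<^sup>2) = (\<Sum>k\<in>F. (c k)\<^sup>2)"
proof -
  note ortho = expectation_prod_mult_prod[OF \<open>finite I\<close> indep mean var]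
  have hI: "h k \<subseteq> I" if "k \<in> F" for k
    using that assms by blast
  have "(\<Sum>k\<in>F. c k * (\<Prod>i\<in>h k. Z i \<omega>))\<^sup>2
    = (\<Sum>k\<in>F. \<Sum>l\<in>F. c k * c l * ((\<Prod>i\<in>h k. Z i \<omega>) * (\<Prod>i\<in>h l. Z i \<omega>)))" for \<omega>
    unfolding power2_eq_square sum_product by (intro sum.cong refl) simp
  then have "expectation (\<lambda>\<omega>. (\<Sum>k\<in>F. c k * (\<Prod>i\<in>h k. Z i \<omega>))\<^sup>2)
    = (\<Sum>k\<in>F. \<Sum>l\<in>F. c k * c l * expectation (\<lambda>\<omega>. (\<Prod>i\<in>h k. Z i \<omega>) * (\<Prod>i\<in>h l. Z i \<omega>)))"
    using ortho(1) hI by (simp add: Bochner_Integration.integral_sum)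
  also have "\<dots> = (\<Sum>k\<in>F. \<Sum>l\<in>F. if k = l then (c k)\<^sup>2 else 0)"
  proof (intro sum.cong refl)
    fix k l assume "k \<in> F" "l \<in> F"
    then have "h k = h l \<longleftrightarrow> k = l"
      using \<open>inj_on h F\<close> by (auto dest: inj_onD)
    then show "c k * c l * expectation (\<lambda>\<omega>. (\<Prod>i\<in>h k. Z i \<omega>) * (\<Prod>i\<in>h l. Z i \<omega>))
      = (if k = l then (c k)\<^sup>2 else 0)"
      using ortho(2) hI \<open>k \<in> F\<close> \<open>l \<in> F\<close> by (simp add: power2_eq_square)
  qed
  also have "\<dots> = (\<Sum>k\<in>F. (c k)\<^sup>2)"
    using \<open>finite F\<close> by simp
  finally show ?thesis .
qed

text \<open>By independence the joint law of the variables is the product of their laws, so the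
  product-space bound applies to a vector of length 1.\<close>

lemma nn_integral_chaos_indep_le:
  fixes Z :: "'i \<Rightarrow> 'a \<Rightarrow> real" and c :: "'i set \<Rightarrow> real" and q \<rho> \<sigma> :: real
  assumes "finite I" and indep: "indep_vars (\<lambda>_. borel) Z I"
    and std: "\<And>i. i \<in> I \<Longrightarrow> standardized q \<sigma> (distr M borel (Z i))"
    and q: "q \<ge> 2" and \<sigma>: "\<sigma> > 0" and \<rho>: "\<bar>\<rho>\<bar> < 1 / (2 * q powr (3 / 2))"
  shows "(\<integral>\<^sup>+\<omega>. ennreal (\<bar>chaos I \<rho> c (\<lambda>i. Z i \<omega>)\<bar> powr q) \<partial>M)
    \<le> ennreal (\<Sum>S\<in>Pow I. \<sigma> powr ((2 - q) * card S) * energy I c S powr (q / 2))"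
\<comment> \<open>The factorization of the joint law is invoked for nonempty \<open>I\<close>;
  without variables the polynomial is the constant \<open>c {}\<close>.\<close>
proof (cases "I = {}")
  case True
  have "{T \<in> Pow {}. {} \<subseteq> T} = {{} :: 'i set}" by auto
  then show ?thesis
    using square_powr_half[of "\<bar>c {}\<bar>" q] \<sigma>
    by (simp add: True chaos_def energy_def emeasure_space_1)
next
  case False
  have meas: "random_variable borel (Z i)" if "i \<in> I" for i
    using indep that by (auto simp: indep_vars_def)
  \<comment> \<open>Outside \<open>I\<close> nothing is known about \<open>Z i\<close>; the point
    mass at 0 makes every \<open>\<mu> i\<close> a Borel probability measure.\<close>
  define \<mu> where "\<mu> i = (if i \<in> I then distr M borel (Z i) else return borel 0)" for i
  have prob: "prob_space (\<mu> i)" and sets: "sets (\<mu> i) = sets borel" for i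
    using meas by (auto simp: \<mu>_def prob_space_distr prob_space_return)
  have std': "standardized q \<sigma> (\<mu> i)" if "i \<in> I" for i
    using that std by (simp add: \<mu>_def)
  have "distr M (PiM I (\<lambda>_. borel)) (\<lambda>\<omega>. \<lambda>i\<in>I. Z i \<omega>) = PiM I (\<lambda>i. distr M borel (Z i))"
    using indep_vars_iff_distr_eq_PiM'[of I Z "\<lambda>_. borel"] False meas indep by blast
  also have "\<dots> = PiM I \<mu>"
    by (intro PiM_cong) (auto simp: \<mu>_def)
  finally have distr: "distr M (PiM I (\<lambda>_. borel)) (\<lambda>\<omega>. \<lambda>i\<in>I. Z i \<omega>) = PiM I \<mu>" .
  have [measurable]: "chaos I \<rho> c \<in> borel_measurable (PiM I (\<lambda>_. borel))"
    by (rule borel_measurable_chaos) simp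
  have rv: "(\<lambda>\<omega>. \<lambda>i\<in>I. Z i \<omega>) \<in> measurable M (PiM I (\<lambda>_. borel))"
    using meas by (intro measurable_restrict) auto
  have "chaos I \<rho> c (\<lambda>i\<in>I. Z i \<omega>) = chaos I \<rho> c (\<lambda>i. Z i \<omega>)" for \<omega>
    unfolding chaos_def by (intro sum.cong arg_cong2[where f = "(*)"] prod.cong) auto
  then have "(\<integral>\<^sup>+\<omega>. ennreal (\<bar>chaos I \<rho> c (\<lambda>i. Z i \<omega>)\<bar> powr q) \<partial>M)
    = (\<integral>\<^sup>+z. ennreal (\<bar>chaos I \<rho> c z\<bar> powr q) \<partial>PiM I \<mu>)"
    unfolding distr[symmetric] by (subst nn_integral_distr[OF rv]) simp_all
  also have "\<dots> = (\<integral>\<^sup>+z. ennreal ((\<Sum>j<1::nat. (chaos I \<rho> c z)\<^sup>2) powr (q / 2)) \<partial>PiM I \<mu>)"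
    using square_powr_half[of "\<bar>_\<bar>" q] by simp
  also have "\<dots> \<le> ennreal (\<Sum>S\<in>Pow I. \<sigma> powr ((2 - q) * card S) * (\<Sum>j<1::nat. energy I c S) powr (q / 2))"
    by (rule nn_integral_chaos_le[OF prob sets q \<sigma> \<rho> \<open>finite I\<close> std'])
  finally show ?thesis by simp
qed

end

section \<open>Return to the noise and derivative operators\<close>

theorem theorem6p1:
  fixes M :: "'a measure" and n :: nat and Z :: "nat \<Rightarrow> 'a \<Rightarrow> real"
    and a :: "nat set \<Rightarrow> real" and q \<sigma> \<rho> :: real
  assumes "prob_space M"
    and "q \<ge> 2" and "\<sigma> > 0"
    and "prob_space.indep_vars M (\<lambda>_. borel) Z {1..n}"
    and "\<And>i. i \<in> {1..n} \<Longrightarrow> (\<integral>\<omega>. Z i \<omega> \<partial>M) = 0"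
    and "\<And>i. i \<in> {1..n} \<Longrightarrow> (\<integral>\<omega>. (Z i \<omega>)\<^sup>2 \<partial>M) = 1"
    and "\<And>i. i \<in> {1..n} \<Longrightarrow> integrable M (\<lambda>\<omega>. \<bar>Z i \<omega>\<bar> powr q)"
    and "\<And>i. i \<in> {1..n} \<Longrightarrow> (\<integral>\<omega>. \<bar>Z i \<omega>\<bar> powr q \<partial>M) \<le> \<sigma> powr (2 - q)"
    and "\<bar>\<rho>\<bar> < 1 / (2 * q powr (3 / 2))"
  shows "Lnorm M q (noise_op n Z \<rho> a) powr q
    \<le> (\<Sum>S\<in>Pow {1..n}. \<sigma> powr ((2 - q) * real (card S)) * Lnorm M 2 (deriv_op n Z S a) powr q)"
proof -
  interpret prob_space M by fact
  let ?I = "{1..n}"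
  have meas: "random_variable borel (Z i)" if "i \<in> ?I" for i
    using assms(4) that by (auto simp: indep_vars_def)
  have std: "standardized q \<sigma> (distr M borel (Z i))" if "i \<in> ?I" for i
    using meas[OF that] assms(5-8)[OF that]
    by (simp add: standardized_def integral_distr integrable_distr_eq)
  have noise: "noise_op n Z \<rho> a = (\<lambda>\<omega>. chaos ?I \<rho> a (\<lambda>i. Z i \<omega>))"
    by (simp add: fun_eq_iff noise_op_def chaos_def)
  have "random_variable borel (noise_op n Z \<rho> a)"
    unfolding noise_op_def[abs_def] using meas
    by (intro borel_measurable_sum borel_measurable_times borel_measurable_prod) auto
  \<comment> \<open>For a nonnegative measurable integrand the Bochner integral is
    \<open>enn2real\<close> of the nonnegative one, so the finite bound carries over.\<close>
  then have "(\<integral>\<omega>. \<bar>noise_op n Z \<rho> a \<omega>\<bar> powr q \<partial>M)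
    = enn2real (\<integral>\<^sup>+\<omega>. ennreal (\<bar>noise_op n Z \<rho> a \<omega>\<bar> powr q) \<partial>M)"
    by (intro integral_eq_nn_integral) auto
  also have "\<dots> \<le> (\<Sum>S\<in>Pow ?I. \<sigma> powr ((2 - q) * card S) * energy ?I a S powr (q / 2))"
    unfolding noise using nn_integral_chaos_indep_le[OF _ assms(4) std assms(2,3,9)]
    by (intro enn2real_leI) (auto intro: sum_nonneg)
  finally have "Lnorm M q (noise_op n Z \<rho> a) powr q
    \<le> (\<Sum>S\<in>Pow ?I. \<sigma> powr ((2 - q) * card S) * energy ?I a S powr (q / 2))"
    using assms(2) by (simp add: Lnorm_def powr_powr)
  moreover have "Lnorm M 2 (deriv_op n Z S a) powr q = energy ?I a S powr (q / 2)"
    if "S \<in> Pow ?I" for S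
  proof -
    \<comment> \<open>Distinct supersets of \<open>S\<close> stay distinct after removing
      \<open>S\<close>, so the monomials of the derivative are orthonormal.\<close>
    have "inj_on (\<lambda>T. T - S) {T \<in> Pow ?I. S \<subseteq> T}"
      by (auto intro!: inj_onI)
    then have "(\<integral>\<omega>. (deriv_op n Z S a \<omega>)\<^sup>2 \<partial>M) = energy ?I a S"
      unfolding deriv_op_def energy_def
      by (intro expectation_sum_prod_square[OF _ assms(4-6)]) auto
    then show ?thesis
      by (simp add: Lnorm_def powr_powr)
  qed
  ultimately show ?thesis by simp
qed

end
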